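(* Let $n$, $s$ and $m$ be positive integers such that $m<ns$, and let $C'$ be an arbitrary real number greater than $1/2$. If $$\frac{m}{s}\geq \frac{\sqrt{C'+1/16}+3/4}{C'-1/2},$$ then for any $m$-dimensional linear subspace $\mathcal{P}$ of $\mathrm{M}_{s,n}(\mathbb{F}_2)$ we have $$\mathrm{WAFOM}(\mathcal{P}) \geq 2^{-C'm^2/s}.$$
   Context: For positive integers $s,n$, $\mathrm{M}_{s,n}(\mathbb{F}_2)$ denotes the set of $s\times n$ matrices over the field $\mathbb{F}_2$ with two elements, regarded as an $sn$-dimensional $\mathbb{F}_2$-vector space with the bilinear inner product $A\cdot B=\sum_{i,j}a_{i,j}b_{i,j}\in\mathbb{F}_2$ for $A=(a_{i,j})$, $B=(b_{i,j})$. For a linear subspace $\mathcal{P}\subseteq \mathrm{M}_{s,n}(\mathbb{F}_2)$, $\mathcal{P}^\bot=\{X\in \mathrm{M}_{s,n}(\mathbb{F}_2) : X\cdot A=0 \text{ for all } A\in\mathcal{P}\}$ is its orthogonal space, and $O$ denotes the zero matrix. The Dick weight of $X=(x_{i,j})\in \mathrm{M}_{s,n}(\mathbb{F}_2)$ is $$\mu(X):=\sum_{1\leq i\leq s,\ 1\leq j\leq n} j\cdot x_{i,j},$$ where each $x_{i,j}\in\{0,1\}$ is regarded as an integer and the sum is taken in $\mathbb{Z}$. The Walsh figure of merit (WAFOM) of a linear subspace $\mathcal{P}$ of $\mathrm{M}_{s,n}(\mathbb{F}_2)$ is the real number $$\mathrm{WAFOM}(\mathcal{P}):=\sum_{X\in\mathcal{P}^\bot\setminus\{O\}}2^{-\mu(X)}.$$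 *)

theory Defs
  imports Complex_Main "HOL-Library.Z2" "Jordan_Normal_Form.VS_Connect"
begin

text \<open>
  The space of \<open>s \<times> n\<close> matrices over the two-element field \<^typ>\<open>bit\<close> is \<open>carrier_mat s n\<close>, with
  vector space structure \<open>module_mat TYPE(bit) s n\<close> over \<open>class_ring\<close>. Matrix indices start at 0,
  so the entry \<open>x\<^sub>i\<^sub>j\<close> with \<open>1 \<le> i \<le> s\<close> and \<open>1 \<le> j \<le> n\<close> is \<open>X $$ (i - 1, j - 1)\<close>.
\<close>

definition mat_inner :: "bit mat \<Rightarrow> bit mat \<Rightarrow> bit" where
  "mat_inner A B = (\<Sum>i<dim_row A. \<Sum>j<dim_col A. A $$ (i, j) * B $$ (i, j))"

definition orthogonal_space :: "nat \<Rightarrow> nat \<Rightarrow> bit mat set \<Rightarrow> bit mat set" where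
  "orthogonal_space s n P = {X \<in> carrier_mat s n. \<forall>A\<in>P. mat_inner X A = 0}"

text \<open>The column factor is \<open>j + 1\<close> because column indices start at 0 here.\<close>

definition dick_weight :: "bit mat \<Rightarrow> nat" where
  "dick_weight X = (\<Sum>i<dim_row X. \<Sum>j<dim_col X. (j + 1) * of_bit (X $$ (i, j)))"

definition WAFOM :: "nat \<Rightarrow> nat \<Rightarrow> bit mat set \<Rightarrow> real" where
  "WAFOM s n P = (\<Sum>X\<in>orthogonal_space s n P - {0\<^sub>m s n}. 2 powr (- real (dick_weight X)))"

text \<open>
  The dimension of a subspace is that of the vector space obtained by restricting the carrier,
  which is how the library writes a subspace as a space in its own right.
\<close>

definition is_subspace_of_dim :: "nat \<Rightarrow> nat \<Rightarrow> nat \<Rightarrow> bit mat set \<Rightarrow> bool" where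
  "is_subspace_of_dim s n m P \<longleftrightarrow>
     VectorSpace.subspace class_ring P (module_mat TYPE(bit) s n) \<and>
     vectorspace.dim class_ring ((module_mat TYPE(bit) s n)\<lparr>carrier := P\<rparr>) = m"

end

theory Submission
  imports Defs
begin

text \<open>
  Let \<open>d = \<lfloor>m / s\<rfloor> + 1 \<le> n\<close>. There are \<open>2\<^bsup>sd\<^esup> > 2\<^bsup>m\<^esup>\<close> matrices supported on the first
  \<open>d\<close> columns, so two of them have the same inner products with \<open>m\<close> generators of \<open>P\<close>; their
  difference is a nonzero \<open>X\<close> in the orthogonal space with \<open>\<mu>(X) \<le> s d (d + 1) / 2\<close>. Keeping only this
  term of WAFOM suffices: with \<open>x = m / s\<close> one has \<open>d (d + 1) / 2 \<le> (x + 1) (x + 2) / 2\<close>, and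
  the hypothesis on \<open>x\<close> says that \<open>x\<close> is at least the larger root of
  \<open>C' x\<^sup>2 - (x + 1) (x + 2) / 2\<close>.
\<close>

text \<open>These rules turn field arithmetic on \<^typ>\<open>bit\<close> into parity case distinctions.\<close>
declare add_bit_eq_xor [simp del] mult_bit_eq_and [simp del] minus_bit_def [simp del]

lemma mat_inner_add_right:
  assumes "A \<in> carrier_mat s n" "B \<in> carrier_mat s n" "C \<in> carrier_mat s n"
  shows "mat_inner A (B + C) = mat_inner A B + mat_inner A C"
proof -
  have "mat_inner A (B + C) =
      (\<Sum>i<s. \<Sum>j<n. A $$ (i, j) * B $$ (i, j) + A $$ (i, j) * C $$ (i, j))"
    using assms unfolding mat_inner_def
    by (intro sum.cong) (auto simp: distrib_left)
  then show ?thesis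
    using assms by (simp add: mat_inner_def sum.distrib)
qed

lemma mat_inner_diff_left:
  assumes "A \<in> carrier_mat s n" "B \<in> carrier_mat s n" "C \<in> carrier_mat s n"
  shows "mat_inner (A - B) C = mat_inner A C - mat_inner B C"
proof -
  have "mat_inner (A - B) C =
      (\<Sum>i<s. \<Sum>j<n. A $$ (i, j) * C $$ (i, j) - B $$ (i, j) * C $$ (i, j))"
    using assms unfolding mat_inner_def
    by (intro sum.cong)
      (auto simp: left_diff_distrib)
  then show ?thesis
    using assms by (simp add: mat_inner_def sum_subtractf)
qed

lemma mat_inner_smult_right:
  assumes "A \<in> carrier_mat s n" "B \<in> carrier_mat s n"
  shows "mat_inner A (c \<cdot>\<^sub>m B) = c * mat_inner A B"
proof -
  have "mat_inner A (c \<cdot>\<^sub>m B) = (\<Sum>i<s. \<Sum>j<n. c * (A $$ (i, j) * B $$ (i, j)))"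
    using assms unfolding mat_inner_def
    by (intro sum.cong) (auto simp: mult.left_commute)
  then show ?thesis
    using assms by (simp add: mat_inner_def sum_distrib_left)
qed

lemma mat_inner_zero_right:
  assumes "A \<in> carrier_mat s n"
  shows "mat_inner A (0\<^sub>m s n) = 0"
  using assms by (simp add: mat_inner_def)

text \<open>Lets orthogonality to a generating set pass to its whole span, because the span lies in
  every submodule containing the generators.\<close>

lemma submodule_mat_inner_zero:
  assumes X: "X \<in> carrier_mat s n"
  shows "submodule class_ring {A \<in> carrier_mat s n. mat_inner X A = 0} (module_mat TYPE(bit) s n)"
proof -
  interpret vectorspace "class_ring :: bit ring" "module_mat TYPE(bit) s n"
    by (rule matrix_vs)
  show ?thesis
    by unfold_locales
      (auto simp: matrix_vs_simps mat_inner_add_right[OF X] mat_inner_smult_right[OF X]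
        mat_inner_zero_right[OF X])
qed

text \<open>A bit matrix is the indicator of its support. Finiteness makes the WAFOM sum genuine,
  since a sum over an infinite set is 0 by convention.\<close>

lemma finite_carrier_mat_bit: "finite (carrier_mat s n :: bit mat set)"
proof (rule finite_subset)
  let ?f = "\<lambda>U. mat s n (\<lambda>p. of_bool (p \<in> U)) :: bit mat"
  show "carrier_mat s n \<subseteq> ?f ` Pow ({..<s} \<times> {..<n})"
  proof
    fix X :: "bit mat" assume X: "X \<in> carrier_mat s n"
    then have "X = ?f {p \<in> {..<s} \<times> {..<n}. X $$ p = 1}"
      by (intro eq_matI) auto
    then show "X \<in> ?f ` Pow ({..<s} \<times> {..<n})"
      by blast
  qed
qed simp

lemma UNIV_bit: "(UNIV :: bit set) = {0, 1}"
  by (auto intro: bit.exhaust)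

text \<open>A basis of \<open>P\<close> serves as \<open>G\<close>, so that membership in the
  orthogonal space reduces to only \<open>m\<close> linear conditions.\<close>

lemma is_subspace_of_dim_generators:
  assumes "is_subspace_of_dim s n m P"
  obtains G where "finite G" "card G = m" "G \<subseteq> P" "P \<subseteq> carrier_mat s n"
    "\<forall>X\<in>carrier_mat s n. (\<forall>A\<in>G. mat_inner X A = 0) \<longrightarrow> (\<forall>A\<in>P. mat_inner X A = 0)"
proof -
  let ?M = "module_mat TYPE(bit) s n"
  interpret V: vectorspace "class_ring :: bit ring" ?M
    by (rule matrix_vs)
  have sub: "VectorSpace.subspace class_ring P ?M"
    and dim: "vectorspace.dim class_ring (?M\<lparr>carrier := P\<rparr>) = m"
    using assms by (auto simp: is_subspace_of_dim_def)
  then have subm: "submodule class_ring P ?M"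
    by (simp add: VectorSpace.subspace_def)
  then have P: "P \<subseteq> carrier_mat s n"
    using submodule.subset by (force simp: module_mat_simps)
  interpret W: vectorspace "class_ring :: bit ring" "?M\<lparr>carrier := P\<rparr>"
    using sub by (rule V.subspace_is_vs)
  have "finite P"
    using P finite_carrier_mat_bit finite_subset by blast
  \<comment> \<open>Being finite, \<open>P\<close> is its own finite spanning set, which gives
    access to a finite basis.\<close>
  have "P \<subseteq> W.span P"
    using W.in_own_span[of P] by simp
  moreover have "W.span P \<subseteq> P"
    using W.span_is_subset2[of P] by simp
  ultimately have "W.fin_dim"
    using \<open>finite P\<close> unfolding W.fin_dim_def by auto
  then obtain G where G: "W.basis G" "finite G"
    using W.finite_basis_exists by blast
  have GP: "G \<subseteq> P" and span: "W.span G = P"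
    using G(1) by (auto simp: W.basis_def)
  have "card G = m"
    using W.dim_basis[OF G(2,1)] dim by simp
  moreover have "\<forall>A\<in>P. mat_inner X A = 0"
    if X: "X \<in> carrier_mat s n" and "\<forall>A\<in>G. mat_inner X A = 0" for X
  proof -
    have "V.span G \<subseteq> {A \<in> carrier_mat s n. mat_inner X A = 0}"
      using that GP P by (intro V.span_is_subset submodule_mat_inner_zero) auto
    \<comment> \<open>The basis spans inside the restricted space \<open>W\<close>, whereas the
      submodule argument lives in the ambient \<open>V\<close>; the two spans agree.\<close>
    moreover have "V.span G = P"
      using V.span_li_not_depend(1)[OF GP subm] span by simp
    ultimately show ?thesis
      by blast
  qed
  ultimately show ?thesis
    using that G(2) GP P by blast
qed

lemma exists_orthogonal_supported_in_columns:
  assumes "finite G" "G \<subseteq> carrier_mat s n" "card G < s * d" "d \<le> n"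
  obtains X where "X \<in> carrier_mat s n" "X \<noteq> 0\<^sub>m s n" "\<forall>A\<in>G. mat_inner X A = 0"
    "\<And>i j. \<lbrakk>i < s; d \<le> j; j < n\<rbrakk> \<Longrightarrow> X $$ (i, j) = 0"
proof -
  let ?D = "{..<s} \<times> {..<d}"
  define f :: "(nat \<times> nat) set \<Rightarrow> bit mat" where "f U = mat s n (\<lambda>p. of_bool (p \<in> U))" for U
  \<comment> \<open>Restricting the function to \<open>G\<close> puts it in an extensional function
    space with exactly \<open>2 ^ card G\<close> elements.\<close>
  define \<phi> where "\<phi> U = (\<lambda>A\<in>G. mat_inner (f U) A)" for U
  have f: "f U \<in> carrier_mat s n" for U
    by (simp add: f_def)
  have "\<phi> ` Pow ?D \<subseteq> G \<rightarrow>\<^sub>E (UNIV :: bit set)"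
    by (auto simp: \<phi>_def)
  moreover have "finite (G \<rightarrow>\<^sub>E (UNIV :: bit set))"
    using assms(1) by (intro finite_PiE) (auto simp: UNIV_bit)
  ultimately have "card (\<phi> ` Pow ?D) \<le> card (G \<rightarrow>\<^sub>E (UNIV :: bit set))"
    by (rule card_mono[rotated])
  also have "\<dots> = 2 ^ card G"
    using assms(1) by (simp add: card_PiE UNIV_bit numeral_2_eq_2)
  also have "\<dots> < 2 ^ (s * d)"
    using assms(3) by simp
  also have "\<dots> = card (Pow ?D)"
    by (simp add: card_Pow)
  finally have "\<not> inj_on \<phi> (Pow ?D)"
    by (rule pigeonhole)
  then obtain U V where UV: "U \<subseteq> ?D" "V \<subseteq> ?D" "U \<noteq> V" "\<phi> U = \<phi> V"
    by (auto simp: inj_on_def)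
  show ?thesis
  proof (rule that[of "f U - f V"])
    show "f U - f V \<in> carrier_mat s n"
      using f by (rule minus_carrier_mat)
    \<comment> \<open>Where \<open>U\<close> and \<open>V\<close> differ, the difference has entry
      1; \<open>d \<le> n\<close> ensures that this position lies inside the matrix.\<close>
    obtain i j where ij: "(i, j) \<in> U \<longleftrightarrow> (i, j) \<notin> V"
      using UV(3) by auto
    then have "i < s" "j < n"
      using UV(1,2) assms(4) by auto
    then have "(f U - f V) $$ (i, j) \<noteq> 0\<^sub>m s n $$ (i, j)"
      using ij by (auto simp: f_def)
    then show "f U - f V \<noteq> 0\<^sub>m s n"
      by metis
    show "\<forall>A\<in>G. mat_inner (f U - f V) A = 0"
    proof
      fix A assume A: "A \<in> G"
      then have "mat_inner (f U) A = mat_inner (f V) A"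
        using fun_cong[OF UV(4), of A] by (simp add: \<phi>_def)
      then show "mat_inner (f U - f V) A = 0"
        using mat_inner_diff_left[OF f f, of A U V] A assms(2) by auto
    qed
    show "(f U - f V) $$ (i, j) = 0" if "i < s" "d \<le> j" "j < n" for i j
      using that UV(1,2) by (auto simp: f_def)
  qed
qed

text \<open>The worst case is a row of \<open>d\<close> ones, contributing 1 + ... + d. The factor 2
  avoids division of naturals.\<close>

lemma dick_weight_supported_in_columns:
  assumes X: "X \<in> carrier_mat s n"
    and zero: "\<And>i j. \<lbrakk>i < s; d \<le> j; j < n\<rbrakk> \<Longrightarrow> X $$ (i, j) = 0"
  shows "2 * dick_weight X \<le> s * (d * (d + 1))"
proof -
  have row: "(\<Sum>j<n. (j + 1) * of_bit (X $$ (i, j))) \<le> (\<Sum>j<d. j + 1)" if "i < s" for i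
  proof -
    have "(\<Sum>j<n. (j + 1) * of_bit (X $$ (i, j))) \<le> (\<Sum>j<n. if j < d then j + 1 else 0)"
      using zero[OF that] by (intro sum_mono) auto
    \<comment> \<open>The intersection covers both orders of \<open>d\<close> and
      \<open>n\<close>.\<close>
    also have "\<dots> = (\<Sum>j\<in>{..<n} \<inter> {..<d}. j + 1)"
      by (subst sum.inter_restrict) auto
    also have "\<dots> \<le> (\<Sum>j<d. j + 1)"
      by (intro sum_mono2) auto
    finally show ?thesis .
  qed
  have gauss: "2 * (\<Sum>j<d. j + 1) = d * (d + 1)"
    by (induction d) auto
  have "dick_weight X = (\<Sum>i<s. \<Sum>j<n. (j + 1) * of_bit (X $$ (i, j)))"
    using X by (simp only: dick_weight_def carrier_matD)
  also have "\<dots> \<le> (\<Sum>i<s. \<Sum>j<d. j + 1)"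
    using row by (intro sum_mono) simp_all
  also have "\<dots> = s * (\<Sum>j<d. j + 1)"
    by simp
  finally have "dick_weight X \<le> s * (\<Sum>j<d. j + 1)" .
  then have "2 * dick_weight X \<le> s * (2 * (\<Sum>j<d. j + 1))"
    by simp
  then show ?thesis
    unfolding gauss .
qed

text \<open>With \<open>a = C - 1 / 2\<close>, the right side minus the left is a x^2 - 3/2 x - 1.
  Multiplied by \<open>a\<close> it becomes the completed square (a x - 3/4)^2 - (a + 9/16), where a
  + 9/16 = C + 1/16.\<close>

lemma quadratic_bound:
  fixes x C :: real
  assumes "C > 1 / 2" and x: "x \<ge> (sqrt (C + 1 / 16) + 3 / 4) / (C - 1 / 2)"
  shows "(x + 1) * (x + 2) / 2 \<le> C * x\<^sup>2"
proof -
  define a where "a = C - 1 / 2"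
  have C: "C = a + 1 / 2" and "a > 0"
    using assms(1) by (auto simp: a_def)
  have "sqrt (C + 1 / 16) \<le> a * x - 3 / 4"
    using x \<open>a > 0\<close> by (simp add: a_def [symmetric] field_simps)
  then have "(sqrt (C + 1 / 16))\<^sup>2 \<le> (a * x - 3 / 4)\<^sup>2"
    using assms(1) by (intro power_mono) auto
  then have "a + 9 / 16 \<le> (a * x - 3 / 4)\<^sup>2"
    using \<open>a > 0\<close> by (simp add: C)
  then have "0 \<le> a * (a * x\<^sup>2 - 3 / 2 * x - 1)"
    by (simp add: power2_eq_square algebra_simps)
  then have "0 \<le> a * x\<^sup>2 - 3 / 2 * x - 1"
    using \<open>a > 0\<close> by (simp add: zero_le_mult_iff)
  then show ?thesis
    by (simp add: C power2_eq_square field_simps)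
qed

theorem theorem3p1:
  fixes n s m :: nat and C' :: real
  assumes "n > 0" and "s > 0" and "m > 0" and "m < n * s"
    and "C' > 1 / 2"
    and "real m / real s \<ge> (sqrt (C' + 1 / 16) + 3 / 4) / (C' - 1 / 2)"
  shows "\<forall>P :: bit mat set. is_subspace_of_dim s n m P \<longrightarrow>
           WAFOM s n P \<ge> 2 powr (- C' * (real m)\<^sup>2 / real s)"
proof (intro allI impI)
  fix P :: "bit mat set"
  assume "is_subspace_of_dim s n m P"
  then obtain G where G: "finite G" "card G = m" "G \<subseteq> P" "P \<subseteq> carrier_mat s n"
    "\<forall>X\<in>carrier_mat s n. (\<forall>A\<in>G. mat_inner X A = 0) \<longrightarrow> (\<forall>A\<in>P. mat_inner X A = 0)"
    by (rule is_subspace_of_dim_generators)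
  \<comment> \<open>The least number of columns whose \<open>s * d\<close> entries outnumber the
    \<open>m\<close> conditions; \<open>m < n * s\<close> guarantees that so many columns
    exist.\<close>
  define d where "d = m div s + 1"
  have "d \<le> n"
    using assms(4) by (simp add: d_def Suc_le_eq less_mult_imp_div_less)
  have "m < s * d"
    using dividend_less_times_div[OF assms(2), of m] by (simp add: d_def)
  then obtain X where X: "X \<in> carrier_mat s n" "X \<noteq> 0\<^sub>m s n" "\<forall>A\<in>G. mat_inner X A = 0"
    "\<And>i j. \<lbrakk>i < s; d \<le> j; j < n\<rbrakk> \<Longrightarrow> X $$ (i, j) = 0"
    using exists_orthogonal_supported_in_columns[of G s n d] G \<open>d \<le> n\<close> by blast
  define x where "x = real m / real s"
  have "real d \<le> x + 1"
    using of_nat_div_le_of_nat[of m s, where ?'a = real] by (simp add: d_def x_def)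
  then have "real d * (real d + 1) \<le> (x + 1) * (x + 2)"
    by (intro mult_mono) auto
  then have "real s * (real d * (real d + 1)) / 2 \<le> real s * ((x + 1) * (x + 2) / 2)"
    by (simp add: mult_left_mono)
  moreover have "real s * ((x + 1) * (x + 2) / 2) \<le> real s * (C' * x\<^sup>2)"
    using assms(5,6) by (intro mult_left_mono quadratic_bound) (auto simp: x_def)
  moreover have "real s * (C' * x\<^sup>2) = C' * (real m)\<^sup>2 / real s"
    using assms(2) by (simp add: x_def power2_eq_square)
  moreover have "2 * dick_weight X \<le> s * (d * (d + 1))"
    using X(1,4) by (rule dick_weight_supported_in_columns)
  then have "real (2 * dick_weight X) \<le> real (s * (d * (d + 1)))"
    by (rule of_nat_mono)
  then have "2 * real (dick_weight X) \<le> real s * (real d * (real d + 1))"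
    by (simp add: algebra_simps)
  ultimately have "real (dick_weight X) \<le> C' * (real m)\<^sup>2 / real s"
    by linarith
  then have "2 powr (- C' * (real m)\<^sup>2 / real s) \<le> 2 powr (- real (dick_weight X))"
    by simp
  also have "\<dots> \<le> WAFOM s n P"
    unfolding WAFOM_def
  proof (rule member_le_sum)
    show "X \<in> orthogonal_space s n P - {0\<^sub>m s n}"
      using X(1-3) G(5) by (simp add: orthogonal_space_def)
    show "finite (orthogonal_space s n P - {0\<^sub>m s n})"
      using finite_carrier_mat_bit by (simp add: orthogonal_space_def)
  qed simp
  finally show "2 powr (- C' * (real m)\<^sup>2 / real s) \<le> WAFOM s n P" .
qed

end
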